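(* Let $W\ge 1$ and $\gamma\ge 1$ be real numbers. For every fixed $p\in[1,\infty)$, the error shape operator $\Lambda:S\to L^p(\Omega)$ is continuous, where $S$ carries the topology induced by the $L^2$-norm and $L^p(\Omega)$ that of the $L^p$-norm.
   Context: The Fourier transform is $\widehat{f}(x)=\int_{\mathbb{R}}f(t)e^{-2\pi i xt}\,dt$. $I_W=[-W,W]$; $L^2(I_W)$ is the space of complex-valued square-integrable functions on $I_W$, extended by zero to $\mathbb{R}$; $S=\{C\in L^2(I_W): \|C\|_2=1\}$. $\Omega=[-\tfrac12,\tfrac12)$ with Lebesgue measure, and $L^p(\Omega)$ is the space of real-valued functions on $\Omega$ with finite $p$-norm. The error shape operator $\Lambda$ is defined by $$\Lambda C(x)=\frac{\sum_{m\in\mathbb{Z},\,m\neq 0}|\widehat{C}(x/\gamma+m)|^2}{\sum_{m\in\mathbb{Z}}|\widehat{C}(x/\gamma+m)|^2}\qquad(\text{for almost every }x\in\Omega).$$ *)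

theory Defs
  imports "HOL-Analysis.Analysis"
begin

definition Lp_norm :: "'a measure \<Rightarrow> real \<Rightarrow> ('a \<Rightarrow> 'b::real_normed_vector) \<Rightarrow> real" where
  "Lp_norm M p f = (LINT x|M. norm (f x) powr p) powr (1 / p)"

text \<open>
  The elements of this set are functions, not classes of functions modulo equality almost
  everywhere. Accordingly \<^term>\<open>\<lambda>f g. Lp_norm M p (\<lambda>x. f x - g x)\<close> is only a pseudometric on
  it (for \<open>p \<ge> 1\<close>), with distance 0 exactly when \<open>f = g\<close> almost everywhere.
\<close>

definition Lp_space ::
    "'a measure \<Rightarrow> real \<Rightarrow> ('a \<Rightarrow> 'b::real_normed_vector) set" where
  "Lp_space M p = {f \<in> borel_measurable M. integrable M (\<lambda>x. norm (f x) powr p)}"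

text \<open>
  The topology that a pseudometric \<open>d\<close> induces on a set. (\<^const>\<open>Metric_space.mtopology\<close> is not
  applicable, because distinct points may have distance 0.) A continuous map between two such
  spaces sends points at distance 0 to points at distance 0, so it is the same as a continuous
  map between the quotient metric spaces.
\<close>

definition pseudometric_topology :: "'a set \<Rightarrow> ('a \<Rightarrow> 'a \<Rightarrow> real) \<Rightarrow> 'a topology" where
  "pseudometric_topology S d =
     topology (\<lambda>U. U \<subseteq> S \<and> (\<forall>x\<in>U. \<exists>\<epsilon>>0. \<forall>y\<in>S. d x y < \<epsilon> \<longrightarrow> y \<in> U))"

lemma openin_pseudometric_topology:
  "openin (pseudometric_topology S d) U \<longleftrightarrow>
     U \<subseteq> S \<and> (\<forall>x\<in>U. \<exists>\<epsilon>>0. \<forall>y\<in>S. d x y < \<epsilon> \<longrightarrow> y \<in> U)"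
proof -
  have "istopology (\<lambda>U. U \<subseteq> S \<and> (\<forall>x\<in>U. \<exists>\<epsilon>>0. \<forall>y\<in>S. d x y < \<epsilon> \<longrightarrow> y \<in> U))"
    unfolding istopology_def
  proof (intro conjI allI impI)
    fix U V
    assume U: "U \<subseteq> S \<and> (\<forall>x\<in>U. \<exists>\<epsilon>>0. \<forall>y\<in>S. d x y < \<epsilon> \<longrightarrow> y \<in> U)"
      and V: "V \<subseteq> S \<and> (\<forall>x\<in>V. \<exists>\<epsilon>>0. \<forall>y\<in>S. d x y < \<epsilon> \<longrightarrow> y \<in> V)"
    show "U \<inter> V \<subseteq> S"
      using U by blast
    show "\<forall>x\<in>U \<inter> V. \<exists>\<epsilon>>0. \<forall>y\<in>S. d x y < \<epsilon> \<longrightarrow> y \<in> U \<inter> V"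
    proof
      fix x assume "x \<in> U \<inter> V"
      then have "x \<in> U" "x \<in> V"
        by simp_all
      obtain a where "a > 0" "\<forall>y\<in>S. d x y < a \<longrightarrow> y \<in> U"
        using U \<open>x \<in> U\<close> by blast
      moreover obtain b where "b > 0" "\<forall>y\<in>S. d x y < b \<longrightarrow> y \<in> V"
        using V \<open>x \<in> V\<close> by blast
      ultimately show "\<exists>\<epsilon>>0. \<forall>y\<in>S. d x y < \<epsilon> \<longrightarrow> y \<in> U \<inter> V"
        by (intro exI[of _ "min a b"]) auto
    qed
  next
    fix K
    assume K: "\<forall>U\<in>K. U \<subseteq> S \<and> (\<forall>x\<in>U. \<exists>\<epsilon>>0. \<forall>y\<in>S. d x y < \<epsilon> \<longrightarrow> y \<in> U)"
    then show "\<Union>K \<subseteq> S"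
      by blast
    show "\<forall>x\<in>\<Union>K. \<exists>\<epsilon>>0. \<forall>y\<in>S. d x y < \<epsilon> \<longrightarrow> y \<in> \<Union>K"
    proof
      fix x assume "x \<in> \<Union>K"
      then obtain U where "U \<in> K" "x \<in> U"
        by blast
      moreover from this K obtain \<epsilon> where "\<epsilon> > 0" "\<forall>y\<in>S. d x y < \<epsilon> \<longrightarrow> y \<in> U"
        by blast
      ultimately show "\<exists>\<epsilon>>0. \<forall>y\<in>S. d x y < \<epsilon> \<longrightarrow> y \<in> \<Union>K"
        by (intro exI[of _ \<epsilon>]) blast
    qed
  qed
  then show ?thesis
    by (simp add: pseudometric_topology_def topology_inverse')
qed

lemma topspace_pseudometric_topology [simp]: "topspace (pseudometric_topology S d) = S"
proof
  show "topspace (pseudometric_topology S d) \<subseteq> S"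
    using openin_topspace[of "pseudometric_topology S d"]
    unfolding openin_pseudometric_topology by (rule conjunct1)
  have "openin (pseudometric_topology S d) S"
    unfolding openin_pseudometric_topology by (meson order_refl zero_less_one)
  then show "S \<subseteq> topspace (pseudometric_topology S d)"
    by (rule openin_subset)
qed

definition Lp_topology ::
    "'a measure \<Rightarrow> real \<Rightarrow> ('a \<Rightarrow> 'b::real_normed_vector) topology" where
  "Lp_topology M p =
     pseudometric_topology (Lp_space M p) (\<lambda>f g. Lp_norm M p (\<lambda>x. f x - g x))"

definition L2_interval :: "real \<Rightarrow> (real \<Rightarrow> complex) set" where
  "L2_interval W = {C \<in> Lp_space lebesgue 2. \<forall>t. t \<notin> {-W..W} \<longrightarrow> C t = 0}"

definition L2_sphere :: "real \<Rightarrow> (real \<Rightarrow> complex) set" where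
  "L2_sphere W = {C \<in> L2_interval W. Lp_norm lebesgue 2 C = 1}"

definition fourier :: "(real \<Rightarrow> complex) \<Rightarrow> real \<Rightarrow> complex" where
  "fourier f x = (LINT t|lebesgue. f t * exp (- (2 * pi * \<i> * x * t)))"

definition Omega :: "real set" where
  "Omega = {-1/2..<1/2}"

text \<open>
  Where the denominator is 0 or a series diverges, the value below is a dummy value
  (\<open>x / 0 = 0\<close>, and a divergent infinite sum is 0).
\<close>

definition error_shape :: "real \<Rightarrow> (real \<Rightarrow> complex) \<Rightarrow> real \<Rightarrow> real" where
  "error_shape \<gamma> C x =
     (\<Sum>\<^sub>\<infinity>m\<in>{m::int. m \<noteq> 0}. (cmod (fourier C (x / \<gamma> + of_int m)))\<^sup>2) /
     (\<Sum>\<^sub>\<infinity>m\<in>(UNIV::int set). (cmod (fourier C (x / \<gamma> + of_int m)))\<^sup>2)"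

definition error_shape_defined_at :: "real \<Rightarrow> (real \<Rightarrow> complex) \<Rightarrow> real \<Rightarrow> bool" where
  "error_shape_defined_at \<gamma> C x \<longleftrightarrow>
     (\<lambda>m::int. (cmod (fourier C (x / \<gamma> + of_int m)))\<^sup>2) summable_on UNIV \<and>
     (\<Sum>\<^sub>\<infinity>m\<in>(UNIV::int set). (cmod (fourier C (x / \<gamma> + of_int m)))\<^sup>2) \<noteq> 0"

end

theory Submission
  imports Defs "HOL-Complex_Analysis.Complex_Analysis"
begin

text \<open>
  Write \<open>F\<close> for the Fourier transform of \<open>C\<close>, and \<open>y = x / \<gamma>\<close>. Numerator and denominator of the
  error shape are squared \<open>\<ell>\<^sup>2\<close> norms of the samples \<open>F (y + m)\<close>, with \<open>m\<close> running over
  a set \<open>A\<close> of integers. Three facts give continuity.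

  \<^item> If \<open>N \<ge> W\<close> is a positive integer, then \<open>F (y + m)\<close> is the scalar product of \<open>C\<close> with an exponential,
    and as \<open>m\<close> varies these exponentials are orthogonal on \<open>{-N..N}\<close>, an interval whose length
    \<open>2 * N\<close> is an integer number of periods. Bessel's inequality bounds the energy of the samples by
    \<open>2 * N\<close> times the squared \<open>L\<^sup>2\<close> norm of \<open>C\<close> (\<open>bessel_finite\<close>). Hence the
    series converge at every point, and on the sphere their values are Lipschitz in \<open>C\<close>,
    uniformly in \<open>x\<close> (\<open>sample_energy_diff_le\<close>).

  \<^item> As \<open>C\<close> has compact support, \<open>F\<close> extends to an entire function, whose Taylor coefficients at 0
    are multiples of the moments of \<open>C\<close>. If \<open>F\<close> had uncountably many zeros, all moments would
    vanish; \<open>C\<close> would then be orthogonal to all polynomials, by Weierstrass to all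
    continuous functions, and so would be 0 almost everywhere. For \<open>C\<close> on the
    sphere the zeros of \<open>F\<close> are therefore countable (\<open>fourier_countable_zeros\<close>), and the denominator, which is
    at least the square of \<open>\<bar>F y\<bar>\<close>, is nonzero for almost every \<open>x\<close>.

  \<^item> If a sequence on the sphere converges to \<open>C\<close>, then by the first two facts its error shapes converge
    almost everywhere to that of \<open>C\<close>. All of them take values between 0 and 1, and the domain has finite
    measure, so dominated convergence gives convergence in \<open>L\<^sup>p\<close>
    (\<open>error_shape_tendsto_Lp\<close>).

  The limit of the quotients is taken pointwise because the denominators have no positive lower bound
  that is uniform in \<open>x\<close> and \<open>C\<close>. The argument therefore gives no modulus of continuity.
\<close>

section \<open>The topology of square-integrable functions\<close>

lemma Lp_norm_2:
  "Lp_norm M 2 f = sqrt (LINT x|M. (norm (f x))\<^sup>2)"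
  by (simp add: Lp_norm_def powr_half_sqrt)

lemma integrable_L2_diff:
  fixes f g :: "'a \<Rightarrow> complex"
  assumes [measurable]: "f \<in> borel_measurable M" "g \<in> borel_measurable M"
    and "integrable M (\<lambda>t. (cmod (f t))\<^sup>2)" "integrable M (\<lambda>t. (cmod (g t))\<^sup>2)"
  shows "integrable M (\<lambda>t. (cmod (f t - g t))\<^sup>2)"
proof (rule Bochner_Integration.integrable_bound)
  show "integrable M (\<lambda>t. 2 * (cmod (f t))\<^sup>2 + 2 * (cmod (g t))\<^sup>2)"
    using assms by auto
  have "(cmod (a - b))\<^sup>2 \<le> 2 * (cmod a)\<^sup>2 + 2 * (cmod b)\<^sup>2" for a b
  proof -
    have "(cmod (a - b))\<^sup>2 \<le> (cmod a + cmod b)\<^sup>2"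
      by (intro power_mono norm_triangle_ineq4) auto
    also have "\<dots> \<le> 2 * (cmod a)\<^sup>2 + 2 * (cmod b)\<^sup>2"
      using sum_squares_bound[of "cmod a" "cmod b"] by (simp add: power2_sum)
    finally show ?thesis .
  qed
  then show "AE t in M. norm ((cmod (f t - g t))\<^sup>2)
      \<le> norm (2 * (cmod (f t))\<^sup>2 + 2 * (cmod (g t))\<^sup>2)"
    by (intro AE_I2) (simp add: order_trans[OF _ abs_ge_self])
qed measurable

text \<open>
  The pointwise bound is Young's inequality with weight \<open>b / a\<close>. With \<open>a\<close> and \<open>b\<close> the two norms
  its integral would be exactly the square of their sum; taking them slightly larger
  avoids division by a norm that is 0.
\<close>

lemma L2_norm_triangle:
  fixes f g :: "'a \<Rightarrow> complex"
  assumes [measurable]: "f \<in> borel_measurable M" "g \<in> borel_measurable M"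
    and f: "integrable M (\<lambda>t. (cmod (f t))\<^sup>2)" and g: "integrable M (\<lambda>t. (cmod (g t))\<^sup>2)"
  shows "Lp_norm M 2 (\<lambda>t. f t + g t) \<le> Lp_norm M 2 f + Lp_norm M 2 g"
proof (rule field_le_epsilon)
  fix e :: real assume "e > 0"
  define a b where "a = Lp_norm M 2 f + e / 2" and "b = Lp_norm M 2 g + e / 2"
  have less: "Lp_norm M 2 f < a" "Lp_norm M 2 g < b"
    using \<open>e > 0\<close> by (auto simp: a_def b_def)
  let ?I = "\<lambda>f. LINT t|M. (cmod (f t))\<^sup>2"
  have pos: "a > 0" "b > 0"
    using less by (auto simp: Lp_norm_def intro: le_less_trans[OF powr_ge_zero])
  have le: "?I f \<le> a\<^sup>2" "?I g \<le> b\<^sup>2"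
    using less by (simp_all add: Lp_norm_2 sqrt_le_D)
  have young: "(cmod (x + y))\<^sup>2 \<le> (1 + b / a) * (cmod x)\<^sup>2 + (1 + a / b) * (cmod y)\<^sup>2" for x y
  proof -
    have "(cmod (x + y))\<^sup>2 \<le> (cmod x + cmod y)\<^sup>2"
      by (intro power_mono norm_triangle_ineq) auto
    also have "\<dots> \<le> \<dots> + (b * cmod x - a * cmod y)\<^sup>2 / (a * b)"
      using pos by simp
    also have "\<dots> = (1 + b / a) * (cmod x)\<^sup>2 + (1 + a / b) * (cmod y)\<^sup>2"
      using pos by (simp add: field_simps power2_eq_square)
    finally show ?thesis .
  qed
  have "?I (\<lambda>t. f t + g t) \<le> (LINT t|M. (1 + b / a) * (cmod (f t))\<^sup>2 + (1 + a / b) * (cmod (g t))\<^sup>2)"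
    using integrable_L2_diff[of f M "\<lambda>t. - g t"] f g young by (intro integral_mono) auto
  also have "\<dots> = (1 + b / a) * ?I f + (1 + a / b) * ?I g"
    using f g by simp
  also have "\<dots> \<le> (1 + b / a) * a\<^sup>2 + (1 + a / b) * b\<^sup>2"
    using pos le by (intro add_mono mult_left_mono) auto
  also have "\<dots> = (a + b)\<^sup>2"
    using pos by (simp add: field_simps power2_eq_square)
  finally have "Lp_norm M 2 (\<lambda>t. f t + g t) \<le> a + b"
    using pos by (simp add: Lp_norm_2 real_le_lsqrt)
  then show "Lp_norm M 2 (\<lambda>t. f t + g t) \<le> Lp_norm M 2 f + Lp_norm M 2 g + e"
    by (simp add: a_def b_def)
qed

lemma openin_L2_ball:
  fixes f :: "'a \<Rightarrow> complex"
  assumes f: "f \<in> Lp_space M 2"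
  shows "openin (Lp_topology M 2) {g \<in> Lp_space M 2. Lp_norm M 2 (\<lambda>t. f t - g t) < r}"
  unfolding Lp_topology_def openin_pseudometric_topology
proof (intro conjI ballI)
  fix g assume g: "g \<in> {g \<in> Lp_space M 2. Lp_norm M 2 (\<lambda>t. f t - g t) < r}"
  define d where "d = r - Lp_norm M 2 (\<lambda>t. f t - g t)"
  have d: "d > 0" using g by (simp add: d_def)
  have "Lp_norm M 2 (\<lambda>t. f t - h t) < r" if h: "h \<in> Lp_space M 2" "Lp_norm M 2 (\<lambda>t. g t - h t) < d" for h
  proof -
    have "Lp_norm M 2 (\<lambda>t. (f t - g t) + (g t - h t))
        \<le> Lp_norm M 2 (\<lambda>t. f t - g t) + Lp_norm M 2 (\<lambda>t. g t - h t)"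
      using f g h by (intro L2_norm_triangle) (auto simp: Lp_space_def intro!: integrable_L2_diff)
    then show ?thesis using h(2) by (simp add: d_def)
  qed
  with d show "\<exists>\<epsilon>>0. \<forall>y\<in>Lp_space M 2. Lp_norm M 2 (\<lambda>x. g x - y x) < \<epsilon>
      \<longrightarrow> y \<in> {g \<in> Lp_space M 2. Lp_norm M 2 (\<lambda>t. f t - g t) < r}"
    by auto
qed auto

text \<open>
  In a subspace topology the preimage of an open set has to be the trace of a set that is open in
  the whole space. The union of the balls that the \<open>\<epsilon>\<close>-\<open>\<delta>\<close> condition provides is such a set, since
  the triangle inequality makes these balls open.
\<close>

lemma continuous_map_L2_subspace:
  fixes \<Lambda> :: "('a \<Rightarrow> complex) \<Rightarrow> 'b \<Rightarrow> 'c::real_normed_vector"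
  assumes S: "S \<subseteq> Lp_space M 2"
    and \<Lambda>: "\<And>f. f \<in> S \<Longrightarrow> \<Lambda> f \<in> Lp_space N p"
    and cont: "\<And>f \<epsilon>. f \<in> S \<Longrightarrow> \<epsilon> > 0 \<Longrightarrow> \<exists>\<delta>>0. \<forall>g\<in>S. Lp_norm M 2 (\<lambda>t. f t - g t) < \<delta> \<longrightarrow>
              Lp_norm N p (\<lambda>x. \<Lambda> f x - \<Lambda> g x) < \<epsilon>"
  shows "continuous_map (subtopology (Lp_topology M 2) S) (Lp_topology N p) \<Lambda>"
  unfolding continuous_map_def
proof (intro conjI allI impI)
  have tops: "topspace (subtopology (Lp_topology M 2) S) = S"
    using S by (auto simp: Lp_topology_def)
  show "\<Lambda> \<in> topspace (subtopology (Lp_topology M 2) S) \<rightarrow> topspace (Lp_topology N p)"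
    using \<Lambda> by (auto simp: tops) (simp add: Lp_topology_def)
  fix U :: "('b \<Rightarrow> 'c) set"
  assume U: "openin (Lp_topology N p) U"
  define P where "P = {f \<in> S. \<Lambda> f \<in> U}"
  have "\<exists>\<delta>>0. \<forall>g\<in>S. Lp_norm M 2 (\<lambda>t. f t - g t) < \<delta> \<longrightarrow> g \<in> P" if "f \<in> P" for f
  proof -
    obtain \<epsilon> where "\<epsilon> > 0" "\<forall>h\<in>Lp_space N p. Lp_norm N p (\<lambda>x. \<Lambda> f x - h x) < \<epsilon> \<longrightarrow> h \<in> U"
      using U \<open>f \<in> P\<close> unfolding Lp_topology_def openin_pseudometric_topology P_def by blast
    moreover obtain \<delta> where "\<delta> > 0" "\<forall>g\<in>S. Lp_norm M 2 (\<lambda>t. f t - g t) < \<delta> \<longrightarrow>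
              Lp_norm N p (\<lambda>x. \<Lambda> f x - \<Lambda> g x) < \<epsilon>"
      using cont[of f \<epsilon>] \<open>f \<in> P\<close> \<open>\<epsilon> > 0\<close> unfolding P_def by blast
    ultimately show ?thesis using \<Lambda> unfolding P_def by blast
  qed
  then obtain \<delta> where \<delta>: "\<And>f. f \<in> P \<Longrightarrow> \<delta> f > 0"
    "\<And>f g. f \<in> P \<Longrightarrow> g \<in> S \<Longrightarrow> Lp_norm M 2 (\<lambda>t. f t - g t) < \<delta> f \<Longrightarrow> g \<in> P"
    by metis
  define V where "V = (\<Union>f\<in>P. {g \<in> Lp_space M 2. Lp_norm M 2 (\<lambda>t. f t - g t) < \<delta> f})"
  have PS: "P \<subseteq> Lp_space M 2" using S by (auto simp: P_def)
  have "openin (Lp_topology M 2) V"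
    unfolding V_def using PS by (intro openin_Union ballI) (auto intro!: openin_L2_ball)
  moreover have "P = V \<inter> S"
  proof
    show "V \<inter> S \<subseteq> P" unfolding V_def using \<delta>(2) by blast
    show "P \<subseteq> V \<inter> S"
    proof
      fix f assume f: "f \<in> P"
      then have "Lp_norm M 2 (\<lambda>t. f t - f t) < \<delta> f"
        using \<delta>(1) by (simp add: Lp_norm_def)
      with f PS show "f \<in> V \<inter> S" unfolding V_def P_def by blast
    qed
  qed
  ultimately have "openin (subtopology (Lp_topology M 2) S) P"
    unfolding openin_subtopology by blast
  then show "openin (subtopology (Lp_topology M 2) S) {x \<in> topspace (subtopology (Lp_topology M 2) S). \<Lambda> x \<in> U}"
    by (simp only: tops P_def)
qed

section \<open>Square-integrable functions on an interval\<close>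

lemma L2_intervalD:
  assumes "C \<in> L2_interval W"
  shows "C \<in> borel_measurable lebesgue" "integrable lebesgue (\<lambda>t. (cmod (C t))\<^sup>2)"
    "\<And>t. t \<notin> {-W..W} \<Longrightarrow> C t = 0"
  using assms by (auto simp: L2_interval_def Lp_space_def)

lemma L2_interval_diff:
  assumes "f \<in> L2_interval W" "g \<in> L2_interval W"
  shows "(\<lambda>t. f t - g t) \<in> L2_interval W"
  using L2_intervalD[OF assms(1)] L2_intervalD[OF assms(2)]
  by (auto simp: L2_interval_def Lp_space_def intro!: integrable_L2_diff)

text \<open>
  On a bounded interval \<open>L\<^sup>2\<close> is contained in \<open>L\<^sup>1\<close>, because \<open>x \<le> 1 + x\<^sup>2\<close>.
\<close>

lemma L2_interval_mult_bounded_integrable: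
  assumes C: "C \<in> L2_interval W" and [measurable]: "g \<in> borel_measurable lebesgue"
    and b: "\<And>t. t \<in> {-W..W} \<Longrightarrow> cmod (g t) \<le> B"
  shows "integrable lebesgue (\<lambda>t. C t * g t)"
proof (rule Bochner_Integration.integrable_bound)
  note [measurable] = L2_intervalD(1)[OF C]
  have "integrable lebesgue (indicator {-W..W} :: real \<Rightarrow> real)"
    by (intro integrable_real_indicator) (auto simp: emeasure_lborel_Icc_eq)
  then show "integrable lebesgue (\<lambda>t. (indicator {-W..W} t + (cmod (C t))\<^sup>2) * B)"
    using L2_intervalD(2)[OF C] by auto
  have 1: "x \<le> 1 + x\<^sup>2" for x :: real
    using sum_squares_bound[of x 1] by (simp add: power2_eq_square) (smt (verit) zero_le_square)
  have "cmod (C t * g t) \<le> (indicator {-W..W} t + (cmod (C t))\<^sup>2) * B" for t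
  proof (cases "t \<in> {-W..W}")
    case True
    then have "cmod (C t) * cmod (g t) \<le> (1 + (cmod (C t))\<^sup>2) * B"
      by (intro mult_mono 1 b) auto
    with True show ?thesis by (simp add: norm_mult)
  qed (use L2_intervalD(3)[OF C] in simp)
  then show "AE t in lebesgue. norm (C t * g t)
      \<le> norm ((indicator {-W..W} t + (cmod (C t))\<^sup>2) * B)"
    by (intro AE_I2) (simp add: order_trans[OF _ abs_ge_self])
  show "(\<lambda>t. C t * g t) \<in> borel_measurable lebesgue" by measurable
qed

section \<open>Bessel's inequality for samples of the Fourier transform\<close>

lemma continuous_imp_lebesgue_measurable:
  assumes "continuous_on UNIV (g :: real \<Rightarrow> 'a::euclidean_space)"
  shows "g \<in> borel_measurable lebesgue"
  using borel_measurable_continuous_onI[OF assms] by (intro measurable_completion) simp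

lemma fourier_integrable:
  fixes x :: real
  assumes C: "C \<in> L2_interval W"
  shows "integrable lebesgue (\<lambda>t. C t * exp (- (2 * pi * \<i> * x * t)))"
  by (rule L2_interval_mult_bounded_integrable[OF C, where B=1])
    (auto intro!: continuous_imp_lebesgue_measurable continuous_intros)

lemma fourier_diff:
  assumes "f \<in> L2_interval W" "g \<in> L2_interval W"
  shows "fourier (\<lambda>t. f t - g t) x = fourier f x - fourier g x"
  unfolding fourier_def left_diff_distrib
  by (rule Bochner_Integration.integral_diff) (intro fourier_integrable[OF assms(1)] fourier_integrable[OF assms(2)])+

lemma has_bochner_integral_exp_period:
  fixes j :: int
  assumes N: "N > 0"
  shows "has_bochner_integral lebesgue
    (\<lambda>t. indicator {- real N..real N} t *\<^sub>R exp (2 * pi * \<i> * j * t)) (if j = 0 then of_nat (2 * N) else 0)"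
proof -
  define F :: "real \<Rightarrow> complex" where
    "F = (\<lambda>t. if j = 0 then t else exp (2 * pi * \<i> * j * t) / (2 * pi * \<i> * j))"
  have "has_bochner_integral lborel
    (\<lambda>t. indicator {- real N..real N} t *\<^sub>R exp (2 * pi * \<i> * j * t)) (F N - F (- real N))"
  proof (rule has_bochner_integral_FTC_Icc)
    show "(F has_vector_derivative exp (2 * pi * \<i> * j * x)) (at x within {- real N..real N})" for x
    proof (cases "j = 0")
      case True
      then show ?thesis by (auto simp: F_def intro!: derivative_eq_intros)
    next
      case False
      have "((\<lambda>z. exp (2 * pi * \<i> * j * z) / (2 * pi * \<i> * j)) has_field_derivative
          exp (2 * pi * \<i> * j * of_real x)) (at (of_real x) within of_real ` {- real N..real N})"
        using False by (auto intro!: derivative_eq_intros)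
      then have "((\<lambda>z. exp (2 * pi * \<i> * j * z) / (2 * pi * \<i> * j)) \<circ> of_real has_vector_derivative
          1 * exp (2 * pi * \<i> * j * of_real x)) (at x within {- real N..real N})"
        by (intro field_vector_diff_chain_within) (auto intro!: derivative_eq_intros)
      with False show ?thesis by (simp add: F_def o_def)
    qed
  qed (auto intro!: continuous_intros)
  moreover have "F N - F (- real N) = (if j = 0 then of_nat (2 * N) else 0)"
  proof (cases "j = 0")
    case False
    have "exp (2 * pi * \<i> * j * real N) = 1" "exp (2 * pi * \<i> * j * (- real N)) = 1"
      unfolding exp_eq_1 by (auto intro: exI[of _ "j * int N"] exI[of _ "- j * int N"])
    then show ?thesis using False by (simp add: F_def)
  qed (simp add: F_def)
  ultimately show ?thesis
    by (auto simp: has_bochner_integral_iff integrable_completion integral_completion)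
qed

text \<open>
  The samples are the coefficients of \<open>C\<close> with respect to the exponentials \<open>e m\<close>, which are orthogonal on
  \<open>{-N..N}\<close> and have squared norm \<open>2 * N\<close>. With \<open>s\<close> the sum of the \<open>e m\<close> weighted by these
  coefficients and \<open>S\<close> the energy of the samples, \<open>s / (2 * N)\<close> is the orthogonal projection of
  \<open>C\<close>, and the squared distance between the two is the squared norm of \<open>C\<close> minus \<open>S / (2 * N)\<close>.
\<close>

lemma bessel_finite:
  fixes y :: real
  assumes C: "C \<in> L2_interval W" and N: "W \<le> real N" "N > 0" and F: "finite (F :: int set)"
  shows "(\<Sum>m\<in>F. (cmod (fourier C (y + m)))\<^sup>2) \<le> 2 * real N * (LINT t|lebesgue. (cmod (C t))\<^sup>2)"
proof -
  define e :: "int \<Rightarrow> real \<Rightarrow> complex" where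
    "e = (\<lambda>m t. indicator {- real N..real N} t *\<^sub>R exp (2 * pi * \<i> * (y + m) * t))"
  define c where "c = (\<lambda>m::int. fourier C (y + m))"
  define S where "S = (\<Sum>m\<in>F. (cmod (c m))\<^sup>2)"
  define s where "s = (\<lambda>t. \<Sum>m\<in>F. c m * e m t)"
  have cnj_e: "cnj (e m t) = indicator {- real N..real N} t *\<^sub>R exp (- (2 * pi * \<i> * (y + m) * t))" for m t
    by (simp add: e_def exp_cnj)
  have "has_bochner_integral lebesgue (\<lambda>t. C t * exp (- (2 * pi * \<i> * (y + m) * t))) (c m)" for m :: int
    using fourier_integrable[OF C, of "y + m"] unfolding has_bochner_integral_iff c_def fourier_def by simp
  moreover have "C t * exp (- (2 * pi * \<i> * (y + m) * t)) = C t * cnj (e m t)" for t and m :: int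
    using L2_intervalD(3)[OF C, of t] N(1) unfolding cnj_e by (auto simp: indicator_def)
  ultimately have Ce: "has_bochner_integral lebesgue (\<lambda>t. C t * cnj (e m t)) (c m)" for m :: int
    by (simp only:)
  have ee: "has_bochner_integral lebesgue (\<lambda>t. e m t * cnj (e n t)) (if m = n then of_nat (2 * N) else 0)" for m n
  proof -
    have "e m t * cnj (e n t) = indicator {- real N..real N} t *\<^sub>R exp (2 * pi * \<i> * of_int (m - n) * t)" for t
      unfolding cnj_e unfolding e_def
      by (auto simp: indicator_def exp_add[symmetric] exp_diff[symmetric] algebra_simps)
    with has_bochner_integral_exp_period[OF N(2), of "m - n"] show ?thesis by (simp only: right_minus_eq)
  qed
  have cc: "z * cnj z = of_real ((cmod z)\<^sup>2)" for z
    by (rule complex_norm_square[symmetric])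
  have Cs: "has_bochner_integral lebesgue (\<lambda>t. C t * cnj (s t)) (of_real S)"
  proof -
    have "has_bochner_integral lebesgue (\<lambda>t. \<Sum>m\<in>F. cnj (c m) * (C t * cnj (e m t))) (\<Sum>m\<in>F. cnj (c m) * c m)"
      by (intro has_bochner_integral_sum has_bochner_integral_mult_right Ce)
    moreover have "(\<Sum>m\<in>F. cnj (c m) * c m) = of_real S"
      unfolding S_def of_real_sum by (intro sum.cong refl) (metis cc mult.commute)
    ultimately show ?thesis by (simp add: s_def sum_distrib_left ac_simps)
  qed
  have ss: "has_bochner_integral lebesgue (\<lambda>t. s t * cnj (s t)) (of_real (2 * real N * S))"
  proof -
    have "has_bochner_integral lebesgue (\<lambda>t. \<Sum>m\<in>F. \<Sum>n\<in>F. (c m * cnj (c n)) * (e m t * cnj (e n t)))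
        (\<Sum>m\<in>F. \<Sum>n\<in>F. (c m * cnj (c n)) * (if m = n then of_nat (2 * N) else 0))"
      by (intro has_bochner_integral_sum has_bochner_integral_mult_right ee)
    moreover have "(\<Sum>m\<in>F. \<Sum>n\<in>F. (c m * cnj (c n)) * (if m = n then of_nat (2 * N) else 0)) = of_real (2 * real N * S)"
      using F by (simp add: S_def sum_distrib_left if_distrib[of "\<lambda>x. _ * x"] cc cong: if_cong)
        (simp add: mult_ac)
    ultimately show ?thesis by (simp add: s_def sum_product mult_ac)
  qed
  have "has_bochner_integral lebesgue (\<lambda>t. (cmod (C t))\<^sup>2 - 2 * (1 / (2 * N)) * Re (C t * cnj (s t))
      + (1 / (2 * N))\<^sup>2 * Re (s t * cnj (s t)))
     ((LINT t|lebesgue. (cmod (C t))\<^sup>2) - 2 * (1 / (2 * N)) * Re (of_real S)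
      + (1 / (2 * N))\<^sup>2 * Re (of_real (2 * real N * S)))"
    using L2_intervalD(2)[OF C]
    by (intro has_bochner_integral_add has_bochner_integral_diff has_bochner_integral_mult_right
        has_bochner_integral_Re Cs ss) (simp add: has_bochner_integral_iff)
  moreover have "(cmod (C t))\<^sup>2 - 2 * (1 / (2 * N)) * Re (C t * cnj (s t))
      + (1 / (2 * N))\<^sup>2 * Re (s t * cnj (s t)) = (cmod (C t - (1 / (2 * N)) * s t))\<^sup>2" for t
    unfolding cmod_power2 by (simp add: power2_eq_square algebra_simps)
  ultimately have "has_bochner_integral lebesgue (\<lambda>t. (cmod (C t - (1 / (2 * N)) * s t))\<^sup>2)
     ((LINT t|lebesgue. (cmod (C t))\<^sup>2) - 2 * (1 / (2 * N)) * S + (1 / (2 * N))\<^sup>2 * (2 * real N * S))"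
    by simp
  then have "0 \<le> (LINT t|lebesgue. (cmod (C t))\<^sup>2) - 2 * (1 / (2 * N)) * S + (1 / (2 * N))\<^sup>2 * (2 * real N * S)"
    by (rule has_bochner_integral_integral_eq[THEN subst]) simp
  then have "S \<le> 2 * real N * (LINT t|lebesgue. (cmod (C t))\<^sup>2)"
    using N(2) by (simp add: field_simps power2_eq_square)
  then show ?thesis by (simp add: S_def c_def)
qed

definition sample_energy :: "int set \<Rightarrow> (real \<Rightarrow> complex) \<Rightarrow> real \<Rightarrow> real" where
  "sample_energy A C y = (\<Sum>\<^sub>\<infinity>m\<in>A. (cmod (fourier C (y + of_int m)))\<^sup>2)"

lemma error_shape_eq:
  "error_shape \<gamma> C x = sample_energy {m. m \<noteq> 0} C (x / \<gamma>) / sample_energy UNIV C (x / \<gamma>)"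
  by (simp add: error_shape_def sample_energy_def)

lemma fourier_samples_summable:
  assumes C: "C \<in> L2_interval W"
  shows "(\<lambda>m::int. (cmod (fourier C (y + of_int m)))\<^sup>2) summable_on A"
proof -
  obtain N :: nat where "W \<le> real N" using real_arch_simple by blast
  then have N: "W \<le> real (Suc N)" "Suc N > 0" by auto
  show ?thesis
  proof (rule nonneg_bdd_above_summable_on)
    show "bdd_above (sum (\<lambda>m::int. (cmod (fourier C (y + of_int m)))\<^sup>2) ` {F. F \<subseteq> A \<and> finite F})"
      unfolding bdd_above_def using bessel_finite[OF C N] by blast
  qed simp
qed

lemma sample_energy_le:
  assumes C: "C \<in> L2_interval W" and N: "W \<le> real N" "N > 0"
  shows "sample_energy A C y \<le> 2 * real N * (LINT t|lebesgue. (cmod (C t))\<^sup>2)"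
  unfolding sample_energy_def
  by (intro infsum_le_finite_sums fourier_samples_summable[OF C] bessel_finite[OF C N])

lemma sample_energy_nonneg: "sample_energy A C y \<ge> 0"
  unfolding sample_energy_def by (rule infsum_nonneg) simp

lemma sample_energy_mono:
  assumes "C \<in> L2_interval W" "A \<subseteq> B"
  shows "sample_energy A C y \<le> sample_energy B C y"
  unfolding sample_energy_def using assms
  by (intro infsum_mono2 fourier_samples_summable[OF assms(1)]) auto

text \<open>
  The difference is at most \<open>u * v\<close> with \<open>u = \<bar>a - b\<bar>\<close> and \<open>v = \<bar>a\<bar> + \<bar>b\<bar>\<close>. Splitting this product with
  a free parameter \<open>s\<close> replaces the Cauchy-Schwarz inequality for series when such bounds are summed.
\<close>

lemma abs_diff_squares_norm_le:
  fixes a b :: complex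
  assumes "s > 0"
  shows "\<bar>(cmod a)\<^sup>2 - (cmod b)\<^sup>2\<bar> \<le> (cmod (a - b))\<^sup>2 / (2 * s) + s * ((cmod a)\<^sup>2 + (cmod b)\<^sup>2)"
proof -
  define u v where "u = cmod (a - b)" and "v = cmod a + cmod b"
  have "\<bar>(cmod a)\<^sup>2 - (cmod b)\<^sup>2\<bar> = \<bar>cmod a - cmod b\<bar> * v"
    by (simp add: v_def power2_eq_square square_diff_square_factored abs_mult mult.commute)
  also have "\<dots> \<le> u * v"
    unfolding u_def v_def by (intro mult_right_mono norm_triangle_ineq3) auto
  also have "\<dots> \<le> u\<^sup>2 / (2 * s) + s / 2 * v\<^sup>2"
  proof -
    have "0 \<le> (u - s * v)\<^sup>2 / (2 * s)" using assms by simp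
    also have "\<dots> = u\<^sup>2 / (2 * s) + s / 2 * v\<^sup>2 - u * v"
      using assms by (simp add: field_simps power2_eq_square)
    finally show ?thesis by simp
  qed
  also have "s / 2 * v\<^sup>2 \<le> s * ((cmod a)\<^sup>2 + (cmod b)\<^sup>2)"
  proof -
    have "v\<^sup>2 \<le> 2 * ((cmod a)\<^sup>2 + (cmod b)\<^sup>2)"
      using sum_squares_bound[of "cmod a" "cmod b"] by (simp add: v_def power2_sum)
    then have "s / 2 * v\<^sup>2 \<le> s / 2 * (2 * ((cmod a)\<^sup>2 + (cmod b)\<^sup>2))"
      using assms by (intro mult_left_mono) auto
    then show ?thesis by (simp add: mult.commute mult.left_commute)
  qed
  finally show ?thesis by (simp add: u_def)
qed

text \<open>
  Summing the previous bound over the samples of \<open>C\<close> and \<open>D\<close> and applying Bessel's inequality to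
  \<open>C - D\<close>, \<open>C\<close> and \<open>D\<close> gives a bound that is linear in \<open>s\<close>: the energy of \<open>C - D\<close> is of order \<open>s\<^sup>2\<close> and
  is divided by \<open>s\<close>. For \<open>s\<close> any positive upper bound of the distance between \<open>C\<close> and \<open>D\<close>, this
  is a Lipschitz estimate on bounded sets.
\<close>

lemma sample_energy_diff_le:
  assumes C: "C \<in> L2_interval W" and D: "D \<in> L2_interval W" and N: "W \<le> real N" "N > 0"
    and s: "s > 0" "(LINT t|lebesgue. (cmod (C t - D t))\<^sup>2) \<le> s\<^sup>2"
  shows "\<bar>sample_energy A C y - sample_energy A D y\<bar>
    \<le> real N * s * (1 + 2 * (LINT t|lebesgue. (cmod (C t))\<^sup>2) + 2 * (LINT t|lebesgue. (cmod (D t))\<^sup>2))"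
proof -
  let ?E = "\<lambda>C. \<lambda>m::int. (cmod (fourier C (y + of_int m)))\<^sup>2"
  let ?I = "\<lambda>C::real \<Rightarrow> complex. LINT t|lebesgue. (cmod (C t))\<^sup>2"
  define H where "H = (\<lambda>t. C t - D t)"
  have H: "H \<in> L2_interval W" unfolding H_def by (rule L2_interval_diff[OF C D])
  have fH: "fourier H x = fourier C x - fourier D x" for x
    unfolding H_def by (rule fourier_diff[OF C D])
  note sm = fourier_samples_summable[OF C] fourier_samples_summable[OF D] fourier_samples_summable[OF H]
  let ?R = "\<lambda>m. (1 / (2 * s)) * ?E H m + s * (?E C m + ?E D m)"
  have R: "?R summable_on A"
    by (intro summable_on_add summable_on_cmult_right sm)
  have le: "\<bar>?E C m - ?E D m\<bar> \<le> ?R m" for m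
    using abs_diff_squares_norm_le[OF s(1)] unfolding fH by simp
  have abs: "(\<lambda>m. \<bar>?E C m - ?E D m\<bar>) summable_on A"
    by (rule summable_on_comparison_test[OF R]) (use le in auto)
  have "\<bar>sample_energy A C y - sample_energy A D y\<bar> = norm (\<Sum>\<^sub>\<infinity>m\<in>A. ?E C m - ?E D m)"
    using infsum_add[OF sm(1)[of y A] summable_on_uminus[THEN iffD2, OF sm(2)[of y A]]]
    by (simp add: sample_energy_def infsum_uminus)
  also have "\<dots> \<le> (\<Sum>\<^sub>\<infinity>m\<in>A. norm (?E C m - ?E D m))"
    by (rule norm_infsum_bound) (use abs in simp)
  also have "\<dots> \<le> infsum ?R A"
    by (rule infsum_mono) (use abs R le in auto)
  also have "\<dots> = (1 / (2 * s)) * sample_energy A H y + s * (sample_energy A C y + sample_energy A D y)"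
    unfolding sample_energy_def
    by (simp only: infsum_add summable_on_add summable_on_cmult_right sm infsum_cmult_right)
  also have "\<dots> \<le> (1 / (2 * s)) * (2 * real N * s\<^sup>2) + s * (2 * real N * ?I C + 2 * real N * ?I D)"
  proof (rule add_mono)
    have "sample_energy A H y \<le> 2 * real N * ?I H"
      by (rule sample_energy_le[OF H N])
    also have "\<dots> \<le> 2 * real N * s\<^sup>2"
      using s(2) unfolding H_def by (rule mult_left_mono) simp
    finally show "(1 / (2 * s)) * sample_energy A H y \<le> (1 / (2 * s)) * (2 * real N * s\<^sup>2)"
      by (rule mult_left_mono) (use s(1) in simp)
    have "sample_energy A C y + sample_energy A D y \<le> 2 * real N * ?I C + 2 * real N * ?I D"
      by (rule add_mono[OF sample_energy_le[OF C N] sample_energy_le[OF D N]])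
    then show "s * (sample_energy A C y + sample_energy A D y) \<le> s * (2 * real N * ?I C + 2 * real N * ?I D)"
      by (rule mult_left_mono) (use s(1) in simp)
  qed
  also have "\<dots> = real N * s * (1 + 2 * ?I C + 2 * ?I D)"
    using s(1) by (simp add: field_simps power2_eq_square)
  finally show ?thesis .
qed

section \<open>Zeros of the Fourier transform\<close>

lemma integrable_compact_support_mult_continuous:
  fixes r g :: "real \<Rightarrow> real"
  assumes r: "integrable lebesgue r" and supp: "\<And>t. t \<notin> {a..b} \<Longrightarrow> r t = 0"
    and g: "continuous_on UNIV g"
  shows "integrable lebesgue (\<lambda>t. r t * g t)"
proof -
  have "compact (g ` {a..b})"
    by (intro compact_continuous_image continuous_on_subset[OF g]) auto
  then obtain B where B: "\<And>t. t \<in> {a..b} \<Longrightarrow> \<bar>g t\<bar> \<le> B"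
    by (metis bounded_iff compact_imp_bounded image_eqI real_norm_def)
  have [measurable]: "g \<in> borel_measurable lebesgue"
    by (intro continuous_imp_lebesgue_measurable g)
  show ?thesis
  proof (rule Bochner_Integration.integrable_bound)
    show "integrable lebesgue (\<lambda>t. B * r t)"
      using r by simp
    have "\<bar>r t * g t\<bar> \<le> \<bar>B * r t\<bar>" for t
    proof (cases "t \<in> {a..b}")
      case True
      then have "\<bar>g t\<bar> \<le> \<bar>B\<bar>" using B by fastforce
      then show ?thesis by (metis abs_mult abs_ge_zero mult.commute mult_left_mono)
    qed (simp add: supp)
    then show "AE t in lebesgue. norm (r t * g t) \<le> norm (B * r t)"
      by simp
  qed (use r in measurable)
qed

text \<open>
  By Weierstrass, \<open>g\<close> is a uniform limit on \<open>{a..b}\<close> of polynomials, to which \<open>r\<close> is orthogonal.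
\<close>

lemma moments_zero_imp_orthogonal_continuous:
  fixes r g :: "real \<Rightarrow> real"
  assumes r: "integrable lebesgue r" and supp: "\<And>t. t \<notin> {a..b} \<Longrightarrow> r t = 0"
    and moments: "\<And>n. (LINT t|lebesgue. r t * t ^ n) = 0"
    and g: "continuous_on UNIV g"
  shows "(LINT t|lebesgue. r t * g t) = 0"
proof -
  have int: "integrable lebesgue (\<lambda>t. r t * h t)" if "continuous_on UNIV h" for h
    using integrable_compact_support_mult_continuous[OF r supp that] .
  define I where "I = (LINT t|lebesgue. \<bar>r t\<bar>)"
  have "\<bar>LINT t|lebesgue. r t * g t\<bar> \<le> e * I" if "e > 0" for e
  proof -
    obtain q where q: "real_polynomial_function q" and close: "\<And>t. t \<in> {a..b} \<Longrightarrow> \<bar>g t - q t\<bar> < e"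
      using Stone_Weierstrass_real_polynomial_function[of "{a..b}" g e] continuous_on_subset[OF g] \<open>e > 0\<close>
      by (metis compact_Icc top_greatest)
    obtain c n where qc: "q = (\<lambda>t. \<Sum>i\<le>n. c i * t ^ i)"
      using q real_polynomial_function_iff_sum by blast
    have "(LINT t|lebesgue. r t * q t) = (LINT t|lebesgue. (\<Sum>i\<le>n. c i * (r t * t ^ i)))"
      by (simp add: qc sum_distrib_left mult_ac)
    also have "\<dots> = (\<Sum>i\<le>n. c i * (LINT t|lebesgue. r t * t ^ i))"
      by (subst Bochner_Integration.integral_sum) (auto intro!: int continuous_intros)
    finally have "(LINT t|lebesgue. r t * q t) = 0" by (simp add: moments)
    moreover have cq: "continuous_on UNIV q"
      unfolding qc by (intro continuous_intros)
    ultimately have "(LINT t|lebesgue. r t * g t) = (LINT t|lebesgue. r t * (g t - q t))"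
      by (simp add: right_diff_distrib Bochner_Integration.integral_diff int g)
    also have "\<bar>\<dots>\<bar> \<le> (LINT t|lebesgue. \<bar>r t * (g t - q t)\<bar>)"
      by (rule integral_abs_bound)
    also have "\<dots> \<le> (LINT t|lebesgue. e * \<bar>r t\<bar>)"
    proof (rule integral_mono)
      show "\<bar>r t * (g t - q t)\<bar> \<le> e * \<bar>r t\<bar>" for t
      proof (cases "t \<in> {a..b}")
        case True
        then have "\<bar>g t - q t\<bar> \<le> e" using close by (simp add: less_imp_le)
        then show ?thesis
          unfolding abs_mult by (metis abs_ge_zero mult.commute mult_left_mono)
      qed (simp add: supp)
    qed (use r g cq in \<open>auto intro!: int continuous_intros\<close>)
    finally show ?thesis by (simp add: I_def)
  qed
  note bound = this
  have "I \<ge> 0" by (simp add: I_def)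
  show ?thesis
  proof (rule ccontr)
    assume nz: "(LINT t|lebesgue. r t * g t) \<noteq> 0"
    with bound[of "\<bar>LINT t|lebesgue. r t * g t\<bar> / (I + 1)"] \<open>I \<ge> 0\<close> show False
      by (simp add: field_simps)
  qed
qed

text \<open>
  A measurable function is almost everywhere a limit of continuous functions. Applied to
  \<open>sgn (r t)\<close>, and with the continuous functions clipped to \<open>{-1..1}\<close> so that dominated convergence applies,
  this makes the integral of \<open>\<bar>r\<bar>\<close> a limit of integrals that vanish by orthogonality.
\<close>

lemma moments_zero_imp_AE_zero:
  fixes r :: "real \<Rightarrow> real"
  assumes r: "integrable lebesgue r" and supp: "\<And>t. t \<notin> {a..b} \<Longrightarrow> r t = 0"
    and moments: "\<And>n. (LINT t|lebesgue. r t * t ^ n) = 0"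
  shows "AE t in lebesgue. r t = 0"
proof -
  note [measurable] = borel_measurable_integrable[OF r]
  have "(\<lambda>t. sgn (r t)) \<in> borel_measurable lebesgue" by measurable
  then have "(\<lambda>t. sgn (r t)) measurable_on UNIV"
    by (rule lebesgue_measurable_imp_measurable_on_real) simp
  then obtain N g where N: "negligible N" and g: "\<And>n. continuous_on UNIV (g n)"
    and lim: "\<And>t. t \<notin> N \<Longrightarrow> (\<lambda>n. g n t) \<longlonglongrightarrow> sgn (r t)"
    unfolding measurable_on_def by auto
  define h where "h = (\<lambda>n t. max (-1) (min 1 (g n t)))"
  have h: "continuous_on UNIV (h n)" for n
    unfolding h_def by (intro continuous_intros g)
  have [measurable]: "h n \<in> borel_measurable lebesgue" for n
    by (intro continuous_imp_lebesgue_measurable h)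
  have "(\<lambda>n. LINT t|lebesgue. r t * h n t) \<longlonglongrightarrow> (LINT t|lebesgue. \<bar>r t\<bar>)"
  proof (rule integral_dominated_convergence)
    show "integrable lebesgue (\<lambda>t. \<bar>r t\<bar>)" using r by simp
    have "AE t in lebesgue. t \<notin> N"
      using N by (simp add: AE_not_in negligible_iff_null_sets)
    then show "AE t in lebesgue. (\<lambda>n. r t * h n t) \<longlonglongrightarrow> \<bar>r t\<bar>"
    proof eventually_elim
      case (elim t)
      have "(\<lambda>n. r t * h n t) \<longlonglongrightarrow> r t * max (-1) (min 1 (sgn (r t)))"
        unfolding h_def by (intro tendsto_intros lim elim)
      moreover have "r t * max (-1) (min 1 (sgn (r t))) = \<bar>r t\<bar>"
        by (auto simp: sgn_if)
      ultimately show ?case by simp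
    qed
    have "\<bar>h n t\<bar> \<le> 1" for n t by (auto simp: h_def)
    then show "AE t in lebesgue. norm (r t * h n t) \<le> \<bar>r t\<bar>" for n
      by (intro AE_I2) (simp add: abs_mult mult_left_le)
  qed measurable
  moreover have "(LINT t|lebesgue. r t * h n t) = 0" for n
    by (rule moments_zero_imp_orthogonal_continuous[OF r supp moments h])
  ultimately have "(LINT t|lebesgue. \<bar>r t\<bar>) = 0"
    by (simp add: LIMSEQ_const_iff)
  then have "AE t in lebesgue. \<bar>r t\<bar> = 0"
    using r by (subst (asm) integral_nonneg_eq_0_iff_AE) auto
  then show ?thesis by simp
qed

lemma L2_interval_moments_zero_imp_AE_zero:
  assumes C: "C \<in> L2_interval W" and moments: "\<And>n. (LINT t|lebesgue. C t * of_real t ^ n) = 0"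
  shows "AE t in lebesgue. C t = 0"
proof -
  have [measurable]: "(\<lambda>t. complex_of_real t ^ n) \<in> borel_measurable lebesgue" for n
    by (intro continuous_imp_lebesgue_measurable continuous_intros)
  have int: "integrable lebesgue (\<lambda>t. C t * of_real t ^ n)" for n
    by (rule L2_interval_mult_bounded_integrable[OF C, where B = "\<bar>W\<bar> ^ n"])
      (auto simp: norm_power intro!: power_mono)
  have eq: "Re (C t * of_real t ^ n) = Re (C t) * t ^ n" "Im (C t * of_real t ^ n) = Im (C t) * t ^ n" for t n
    by (simp_all flip: of_real_power)
  have "AE t in lebesgue. Re (C t) = 0"
  proof (rule moments_zero_imp_AE_zero[where a = "-W" and b = W])
    show "(LINT t|lebesgue. Re (C t) * t ^ n) = 0" for n
      using integral_Re[OF int[of n]] by (simp only: eq moments complex.sel zero_complex.sel)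
  qed (use int[of 0] L2_intervalD(3)[OF C] in auto)
  moreover have "AE t in lebesgue. Im (C t) = 0"
  proof (rule moments_zero_imp_AE_zero[where a = "-W" and b = W])
    show "(LINT t|lebesgue. Im (C t) * t ^ n) = 0" for n
      using integral_Im[OF int[of n]] by (simp only: eq moments complex.sel zero_complex.sel)
  qed (use int[of 0] L2_intervalD(3)[OF C] in auto)
  ultimately show ?thesis
    by eventually_elim (simp add: complex_eq_iff)
qed

definition fourier_entire :: "(real \<Rightarrow> complex) \<Rightarrow> complex \<Rightarrow> complex" where
  "fourier_entire C z = (LINT t|lebesgue. C t * exp (- (2 * pi * \<i> * z * t)))"

lemma fourier_eq_fourier_entire: "fourier C x = fourier_entire C (of_real x)"
  by (simp add: fourier_def fourier_entire_def)

text \<open>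
  The exponential series may be integrated termwise because the support of \<open>C\<close> is bounded: with
  \<open>R = 2 * pi * \<bar>z\<bar> * \<bar>W\<bar>\<close>, its \<open>n\<close>th term is at most \<open>\<bar>C t\<bar> * R ^ n / fact n\<close> there.
\<close>

lemma fourier_entire_power_series:
  assumes C: "C \<in> L2_interval W"
  shows "(\<lambda>n. ((- (2 * pi * \<i>)) ^ n / fact n * (LINT t|lebesgue. C t * of_real t ^ n)) * z ^ n)
           sums fourier_entire C z"
proof -
  define f where "f = (\<lambda>n t. C t * ((- (2 * pi * \<i> * z * of_real t)) ^ n / fact n))"
  have meas: "(\<lambda>t. (- (2 * pi * \<i> * z * complex_of_real t)) ^ n / fact n) \<in> borel_measurable lebesgue" for n
    by (intro continuous_imp_lebesgue_measurable continuous_intros) auto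
  define R where "R = 2 * pi * cmod z * \<bar>W\<bar>"
  have bnd: "cmod ((- (2 * pi * \<i> * z * of_real t)) ^ n / fact n) \<le> R ^ n / fact n"
    if "t \<in> {-W..W}" for n t
  proof -
    have "cmod (- (2 * pi * \<i> * z * of_real t)) \<le> R"
      using that unfolding R_def by (auto simp: norm_mult intro!: mult_left_mono)
    then show ?thesis
      unfolding norm_divide norm_power by (auto intro!: divide_right_mono power_mono)
  qed
  have int: "integrable lebesgue (f n)" for n
    unfolding f_def by (rule L2_interval_mult_bounded_integrable[OF C meas bnd])
  have intC: "integrable lebesgue C"
    using L2_interval_mult_bounded_integrable[OF C, of "\<lambda>_. 1" 1] by simp
  have f_exp: "(\<lambda>n. f n t) sums (C t * exp (- (2 * pi * \<i> * z * t)))" for t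
    unfolding f_def
    by (intro sums_mult) (use exp_converges[of "- (2 * pi * \<i> * z * t)"] in \<open>simp add: scaleR_conv_of_real divide_inverse mult.commute\<close>)
  have fb: "norm (f n t) \<le> cmod (C t) * (R ^ n / fact n)" for n t
  proof (cases "t \<in> {-W..W}")
    case True
    then show ?thesis unfolding f_def norm_mult by (intro mult_left_mono bnd) auto
  qed (use L2_intervalD(3)[OF C] in \<open>simp add: f_def\<close>)
  have sR: "summable (\<lambda>n. R ^ n / fact n)"
    using exp_converges[of R] by (auto simp: sums_iff divide_inverse mult.commute)
  have "(\<lambda>n. integral\<^sup>L lebesgue (f n)) sums (LINT t|lebesgue. (\<Sum>n. f n t))"
  proof (rule sums_integral[OF int])
    show "AE t in lebesgue. summable (\<lambda>n. norm (f n t))"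
      by (intro AE_I2 summable_comparison_test'[OF summable_mult[OF sR, of "cmod (C _)"]])
        (use fb in auto)
    show "summable (\<lambda>n. LINT t|lebesgue. norm (f n t))"
    proof (rule summable_comparison_test'[OF summable_mult[OF sR]])
      fix n
      have "norm (LINT t|lebesgue. norm (f n t)) = (LINT t|lebesgue. norm (f n t))"
        by simp
      also have "\<dots> \<le> (LINT t|lebesgue. cmod (C t) * (R ^ n / fact n))"
        using intC int by (intro integral_mono fb) auto
      also have "\<dots> = (LINT t|lebesgue. cmod (C t)) * (R ^ n / fact n)"
        by simp
      finally show "norm (LINT t|lebesgue. norm (f n t)) \<le> (LINT t|lebesgue. cmod (C t)) * (R ^ n / fact n)" .
    qed
  qed
  moreover have "(\<Sum>n. f n t) = C t * exp (- (2 * pi * \<i> * z * t))" for t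
    using f_exp sums_iff by blast
  moreover have "integral\<^sup>L lebesgue (f n)
      = ((- (2 * pi * \<i>)) ^ n / fact n * (LINT t|lebesgue. C t * of_real t ^ n)) * z ^ n" for n
  proof -
    have "f n = (\<lambda>t. ((- (2 * pi * \<i>)) ^ n / fact n * z ^ n) * (C t * of_real t ^ n))"
    proof
      fix t
      have "(- (2 * pi * \<i> * z * of_real t)) ^ n = (- (2 * pi * \<i>)) ^ n * z ^ n * of_real t ^ n"
        by (simp flip: power_mult_distrib)
      then show "f n t = ((- (2 * pi * \<i>)) ^ n / fact n * z ^ n) * (C t * of_real t ^ n)"
        by (simp add: f_def)
    qed
    then show ?thesis by simp
  qed
  ultimately show ?thesis by (simp add: fourier_entire_def)
qed

lemma fourier_entire_holomorphic:
  assumes "C \<in> L2_interval W"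
  shows "fourier_entire C holomorphic_on UNIV"
  unfolding holomorphic_on_def
proof
  fix z :: complex
  have "fourier_entire C holomorphic_on ball 0 (norm z + 1)"
    by (rule power_series_holomorphic) (use fourier_entire_power_series[OF assms] in \<open>simp only: diff_0_right\<close>)
  then show "fourier_entire C field_differentiable at z within UNIV"
    by (simp add: holomorphic_on_open field_differentiable_def)
qed

lemma continuous_on_fourier:
  assumes "C \<in> L2_interval W"
  shows "continuous_on UNIV (fourier C)"
proof -
  have "continuous_on UNIV (fourier_entire C \<circ> of_real)"
    using holomorphic_on_imp_continuous_on[OF fourier_entire_holomorphic[OF assms]]
    by (intro continuous_on_compose) (auto intro: continuous_on_subset continuous_intros)
  then show ?thesis by (simp add: fourier_eq_fourier_entire o_def)
qed

lemma powser_zero_imp_coeffs_zero: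
  fixes a :: "nat \<Rightarrow> complex"
  assumes "\<And>z. (\<lambda>n. a n * z ^ n) sums 0"
  shows "a n = 0"
proof (rule ccontr)
  assume n: "a n \<noteq> 0"
  have "n > 0"
  proof (rule ccontr)
    assume "\<not> n > 0"
    moreover have "a 0 = 0"
      using assms[of 0] sums_unique2 powser_sums_zero by blast
    ultimately show False using n by simp
  qed
  obtain s where "0 < s" "\<And>z. z \<in> cball 0 s - {0} \<Longrightarrow> (\<lambda>z::complex. 0 :: complex) z \<noteq> 0"
    by (rule powser_0_nonzero[of 1 0 a "\<lambda>z. 0" n]) (use assms n \<open>n > 0\<close> in auto)
  from this(2)[of "of_real s"] this(1) show False by simp
qed

text \<open>
  An entire function with uncountably many zeros vanishes identically. Then its power series, hence
  every moment of \<open>C\<close>, is 0, which forces \<open>C\<close> to be 0 almost everywhere.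
\<close>

lemma fourier_countable_zeros:
  assumes C: "C \<in> L2_interval W" and nz: "\<not> (AE t in lebesgue. C t = 0)"
  shows "countable {x. fourier C x = 0}"
proof (rule ccontr)
  assume unc: "uncountable {x. fourier C x = 0}"
  have "uncountable {z. fourier_entire C z = 0}"
  proof
    assume "countable {z. fourier_entire C z = 0}"
    then have "countable (of_real ` {x. fourier C x = 0} :: complex set)"
      by (rule countable_subset[rotated]) (auto simp: fourier_eq_fourier_entire)
    then have "countable {x. fourier C x = 0}"
      by (rule countable_image_inj_on) (simp add: inj_on_def)
    with unc show False ..
  qed
  then have "fourier_entire C = (\<lambda>z. 0)"
    by (intro holomorphic_countable_equal_UNIV fourier_entire_holomorphic[OF C]) auto
  then have "(\<lambda>n. ((- (2 * pi * \<i>)) ^ n / fact n * (LINT t|lebesgue. C t * of_real t ^ n)) * z ^ n) sums 0" for z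
    using fourier_entire_power_series[OF C, of z] by simp
  then have "(- (2 * pi * \<i>)) ^ n / fact n * (LINT t|lebesgue. C t * of_real t ^ n) = 0" for n
    by (rule powser_zero_imp_coeffs_zero)
  then have "(LINT t|lebesgue. C t * of_real t ^ n) = 0" for n
    by simp
  with C nz show False
    using L2_interval_moments_zero_imp_AE_zero by blast
qed

section \<open>The error shape as a function on Omega\<close>

text \<open>
  Enumerating the integers turns the unordered sum into an ordinary series of measurable functions.
\<close>

lemma borel_measurable_sample_energy:
  assumes C: "C \<in> L2_interval W"
  shows "sample_energy A C \<in> borel_measurable borel"
proof -
  define g where "g = (\<lambda>y m::int. if m \<in> A then (cmod (fourier C (y + of_int m)))\<^sup>2 else 0)"
  have [measurable]: "fourier C \<in> borel_measurable borel"
    by (rule borel_measurable_continuous_onI[OF continuous_on_fourier[OF C]])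
  have "sample_energy A C y = (\<Sum>n. g y (int_decode n))" for y
  proof -
    have "(g y) summable_on UNIV"
      using fourier_samples_summable[OF C, of y A]
      by (rule summable_on_cong_neutral[THEN iffD1, rotated -1]) (auto simp: g_def)
    then have "(\<lambda>n. g y (int_decode n)) summable_on UNIV"
      by (subst summable_on_reindex_bij_betw[OF bij_int_decode])
    then have "(\<lambda>n. g y (int_decode n)) sums (\<Sum>\<^sub>\<infinity>n. g y (int_decode n))"
      by (intro has_sum_imp_sums has_sum_infsum)
    moreover have "(\<Sum>\<^sub>\<infinity>n. g y (int_decode n)) = infsum (g y) UNIV"
      by (rule infsum_reindex_bij_betw[OF bij_int_decode])
    moreover have "infsum (g y) UNIV = sample_energy A C y"
      unfolding sample_energy_def by (rule infsum_cong_neutral) (auto simp: g_def)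
    ultimately show ?thesis by (simp add: sums_iff)
  qed
  then have "sample_energy A C = (\<lambda>y. \<Sum>n. g y (int_decode n))"
    by (simp add: fun_eq_iff)
  also have "\<dots> \<in> borel_measurable borel"
    by (intro borel_measurable_suminf) (auto simp: g_def)
  finally show ?thesis .
qed

lemma borel_measurable_error_shape:
  assumes C: "C \<in> L2_interval W"
  shows "error_shape \<gamma> C \<in> borel_measurable (lebesgue_on Omega)"
proof -
  note [measurable] = borel_measurable_sample_energy[OF C]
  have "error_shape \<gamma> C \<in> borel_measurable borel"
    unfolding error_shape_eq by measurable
  then show ?thesis
    by (intro measurable_restrict_space1 measurable_completion) simp
qed

lemma error_shape_bounds:
  assumes C: "C \<in> L2_interval W"
  shows "0 \<le> error_shape \<gamma> C x" "error_shape \<gamma> C x \<le> 1"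
  using sample_energy_nonneg[of _ C] sample_energy_mono[OF C, of "{m. m \<noteq> 0}" UNIV "x / \<gamma>"]
  by (auto simp: error_shape_eq divide_le_eq_1 order_less_le)

lemma integrable_bounded_on_Omega:
  fixes f :: "real \<Rightarrow> real"
  assumes "f \<in> borel_measurable (lebesgue_on Omega)" "\<And>x. \<bar>f x\<bar> \<le> B"
  shows "integrable (lebesgue_on Omega) f"
proof -
  have "emeasure (lebesgue_on Omega) (space (lebesgue_on Omega)) \<noteq> \<infinity>"
    by (simp add: Omega_def emeasure_restrict_space)
  then interpret finite_measure "lebesgue_on Omega"
    by (rule finite_measureI)
  show ?thesis
    by (rule integrable_const_bound[of _ B]) (use assms in auto)
qed

lemma error_shape_in_Lp_space:
  assumes C: "C \<in> L2_interval W" and p: "p \<ge> 0"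
  shows "error_shape \<gamma> C \<in> Lp_space (lebesgue_on Omega) p"
proof -
  note [measurable] = borel_measurable_error_shape[OF C]
  have "integrable (lebesgue_on Omega) (\<lambda>x. norm (error_shape \<gamma> C x) powr p)"
    by (rule integrable_bounded_on_Omega[where B = 1])
      (use error_shape_bounds[OF C] p in \<open>auto intro: powr_le1\<close>)
  then show ?thesis
    by (simp add: Lp_space_def borel_measurable_error_shape[OF C])
qed

lemma L2_sphereD:
  assumes "C \<in> L2_sphere W"
  shows "C \<in> L2_interval W" "(LINT t|lebesgue. (cmod (C t))\<^sup>2) = 1"
  using assms by (simp_all add: L2_sphere_def Lp_norm_2)

lemma L2_sphere_not_AE_zero:
  assumes "C \<in> L2_sphere W"
  shows "\<not> (AE t in lebesgue. C t = 0)"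
proof
  assume zero: "AE t in lebesgue. C t = 0"
  note [measurable] = L2_intervalD(1)[OF L2_sphereD(1)[OF assms]]
  have "(LINT t|lebesgue. (cmod (C t))\<^sup>2) = (LINT t::real|lebesgue. (0 :: real))"
  proof (rule Bochner_Integration.integral_cong_AE)
    show "AE t in lebesgue. (cmod (C t))\<^sup>2 = 0"
      using zero by eventually_elim simp
  qed measurable
  with L2_sphereD(2)[OF assms] show False by simp
qed

text \<open>
  The denominator contains the term \<open>m = 0\<close>, so it can vanish only where \<open>x / \<gamma>\<close> is one of the
  countably many zeros of the Fourier transform.
\<close>

lemma AE_sample_energy_nonzero:
  assumes C: "C \<in> L2_sphere W" and \<gamma>: "\<gamma> \<noteq> 0"
  shows "AE x in lebesgue_on Omega. sample_energy UNIV C (x / \<gamma>) \<noteq> 0"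
proof -
  have "countable {x. fourier C x = 0}"
    using fourier_countable_zeros L2_sphereD[OF C] L2_sphere_not_AE_zero[OF C] by blast
  then have "countable ((\<lambda>y. \<gamma> * y) ` {x. fourier C x = 0})" by simp
  moreover have "{x. sample_energy UNIV C (x / \<gamma>) = 0} \<subseteq> (\<lambda>y. \<gamma> * y) ` {x. fourier C x = 0}"
  proof
    fix x assume x: "x \<in> {x. sample_energy UNIV C (x / \<gamma>) = 0}"
    have "(cmod (fourier C (x / \<gamma>)))\<^sup>2 = sample_energy {0} C (x / \<gamma>)"
      by (simp add: sample_energy_def)
    also have "\<dots> \<le> sample_energy UNIV C (x / \<gamma>)"
      by (rule sample_energy_mono[OF L2_sphereD(1)[OF C]]) simp
    finally have "fourier C (x / \<gamma>) = 0" using x by simp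
    then show "x \<in> (\<lambda>y. \<gamma> * y) ` {x. fourier C x = 0}"
      using \<gamma> by (intro image_eqI[where x = "x / \<gamma>"]) auto
  qed
  ultimately have "countable {x. sample_energy UNIV C (x / \<gamma>) = 0}"
    using countable_subset by blast
  then have "AE x in lebesgue. x \<notin> {x. sample_energy UNIV C (x / \<gamma>) = 0}"
    by (intro AE_not_in null_sets_completionI countable_imp_null_set_lborel)
  then show ?thesis
    by (subst AE_restrict_space_iff) (auto simp: Omega_def)
qed

lemma error_shape_defined_AE:
  assumes C: "C \<in> L2_sphere W" and \<gamma>: "\<gamma> \<noteq> 0"
  shows "AE x in lebesgue_on Omega. error_shape_defined_at \<gamma> C x"
  using AE_sample_energy_nonzero[OF assms]
  by (rule AE_mp) (auto simp: error_shape_defined_at_def sample_energy_def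
      intro: fourier_samples_summable[OF L2_sphereD(1)[OF C]])

section \<open>Continuity of the error shape operator\<close>

text \<open>
  On the sphere the Lipschitz estimate has the constant \<open>5 * N\<close>. It is applied with \<open>s n\<close> slightly
  larger than the distance, since the estimate needs a positive bound and the distance may be 0.
\<close>

lemma sample_energy_tendsto:
  assumes C: "C \<in> L2_sphere W" and X: "\<And>n. X n \<in> L2_sphere W"
    and lim: "(\<lambda>n. Lp_norm lebesgue 2 (\<lambda>t. C t - X n t)) \<longlonglongrightarrow> 0"
  shows "(\<lambda>n. sample_energy A (X n) y) \<longlonglongrightarrow> sample_energy A C y"
proof -
  obtain N0 :: nat where "W \<le> real N0" using real_arch_simple by blast
  then obtain N :: nat where N: "W \<le> real N" "N > 0"
    by (intro that[of "Suc N0"]) auto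
  define d where "d = (\<lambda>n. Lp_norm lebesgue 2 (\<lambda>t. C t - X n t))"
  define s where "s = (\<lambda>n. d n + inverse (real (Suc n)))"
  have d: "d n \<ge> 0" "(LINT t|lebesgue. (cmod (C t - X n t))\<^sup>2) = (d n)\<^sup>2" for n
    by (simp_all add: d_def Lp_norm_2)
  have s: "s n > 0" "(d n)\<^sup>2 \<le> (s n)\<^sup>2" for n
    using d(1)[of n] by (auto simp: s_def intro: add_nonneg_pos power_mono)
  have "\<bar>sample_energy A C y - sample_energy A (X n) y\<bar> \<le> real N * s n * 5" for n
    using sample_energy_diff_le[OF L2_sphereD(1)[OF C] L2_sphereD(1)[OF X[of n]] N s(1)[of n], of A y]
      s(2)[of n] d(2)[of n] L2_sphereD(2)[OF C] L2_sphereD(2)[OF X[of n]]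
    by simp
  then have bound: "norm (sample_energy A (X n) y - sample_energy A C y) \<le> real N * s n * 5" for n
    by (simp add: abs_minus_commute)
  have "(\<lambda>n. real N * s n * 5) \<longlonglongrightarrow> real N * (0 + 0) * 5"
    unfolding s_def d_def
    by (rule tendsto_mult[OF tendsto_mult[OF tendsto_const
          tendsto_add[OF lim LIMSEQ_inverse_real_of_nat]] tendsto_const])
  then have null: "(\<lambda>n. real N * s n * 5) \<longlonglongrightarrow> 0" by simp
  have "(\<lambda>n. sample_energy A (X n) y - sample_energy A C y) \<longlonglongrightarrow> 0"
    by (rule Lim_null_comparison[OF always_eventually null]) (use bound in blast)
  then show ?thesis by (rule LIM_zero_cancel)
qed

lemma error_shape_tendsto_Lp:
  assumes C: "C \<in> L2_sphere W" and X: "\<And>n. X n \<in> L2_sphere W" and \<gamma>: "\<gamma> \<noteq> 0" and p: "p > 0"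
    and lim: "(\<lambda>n. Lp_norm lebesgue 2 (\<lambda>t. C t - X n t)) \<longlonglongrightarrow> 0"
  shows "(\<lambda>n. Lp_norm (lebesgue_on Omega) p (\<lambda>x. error_shape \<gamma> C x - error_shape \<gamma> (X n) x)) \<longlonglongrightarrow> 0"
proof -
  note CI = L2_sphereD(1)[OF C] and XI = L2_sphereD(1)[OF X]
  note [measurable] = borel_measurable_error_shape[OF CI] borel_measurable_error_shape[OF XI]
  let ?D = "\<lambda>n x. norm (error_shape \<gamma> C x - error_shape \<gamma> (X n) x) powr p"
  have "(\<lambda>n. LINT x|lebesgue_on Omega. ?D n x) \<longlonglongrightarrow> (LINT x|lebesgue_on Omega. 0)"
  proof (rule integral_dominated_convergence[where w = "\<lambda>_. 1"])
    show "integrable (lebesgue_on Omega) (\<lambda>x. 1 :: real)"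
      by (rule integrable_bounded_on_Omega[where B = 1]) auto
    show "AE x in lebesgue_on Omega. (\<lambda>n. ?D n x) \<longlonglongrightarrow> 0"
      using AE_sample_energy_nonzero[OF C \<gamma>]
    proof eventually_elim
      case (elim x)
      have "(\<lambda>n. error_shape \<gamma> (X n) x) \<longlonglongrightarrow> error_shape \<gamma> C x"
        unfolding error_shape_eq
        by (rule tendsto_divide[OF sample_energy_tendsto[OF C X lim] sample_energy_tendsto[OF C X lim] elim])
      from tendsto_norm[OF tendsto_diff[OF tendsto_const[of "error_shape \<gamma> C x"] this]]
      have "(\<lambda>n. norm (error_shape \<gamma> C x - error_shape \<gamma> (X n) x)) \<longlonglongrightarrow> 0"
        by simp
      then show ?case
        by (rule tendsto_zero_powrI[OF _ tendsto_const]) (use p in auto)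
    qed
    have "norm (?D n x) \<le> 1" for n x
    proof -
      have "\<bar>error_shape \<gamma> C x - error_shape \<gamma> (X n) x\<bar> \<le> 1"
        using error_shape_bounds[OF CI, of \<gamma> x] error_shape_bounds[OF XI, of \<gamma> n x] by linarith
      then show ?thesis using p by (simp add: powr_le1)
    qed
    then show "AE x in lebesgue_on Omega. norm (?D n x) \<le> 1" for n by simp
  qed measurable
  then have "(\<lambda>n. LINT x|lebesgue_on Omega. ?D n x) \<longlonglongrightarrow> 0"
    by (simp only: integral_zero)
  then have "(\<lambda>n. (LINT x|lebesgue_on Omega. ?D n x) powr (1 / p)) \<longlonglongrightarrow> 0"
    by (rule tendsto_zero_powrI[OF _ tendsto_const]) (use p in auto)
  then show ?thesis by (simp add: Lp_norm_def)
qed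

text \<open>
  A failure of continuity at \<open>C\<close> would yield a sequence on the sphere that converges to \<open>C\<close> while its
  error shapes stay at distance at least \<open>\<epsilon>\<close>. Passing to sequences makes dominated convergence
  applicable.
\<close>

lemma error_shape_continuous_at:
  assumes C: "C \<in> L2_sphere W" and \<gamma>: "\<gamma> \<noteq> 0" and p: "p > 0" and \<epsilon>: "\<epsilon> > 0"
  shows "\<exists>\<delta>>0. \<forall>D\<in>L2_sphere W. Lp_norm lebesgue 2 (\<lambda>t. C t - D t) < \<delta> \<longrightarrow>
    Lp_norm (lebesgue_on Omega) p (\<lambda>x. error_shape \<gamma> C x - error_shape \<gamma> D x) < \<epsilon>"
proof (rule ccontr)
  assume no: "\<not> ?thesis"
  have "\<exists>D\<in>L2_sphere W. Lp_norm lebesgue 2 (\<lambda>t. C t - D t) < inverse (real (Suc n)) \<and>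
    \<not> Lp_norm (lebesgue_on Omega) p (\<lambda>x. error_shape \<gamma> C x - error_shape \<gamma> D x) < \<epsilon>" for n
    using no by (metis inverse_positive_iff_positive of_nat_0_less_iff zero_less_Suc)
  then obtain X where X: "\<And>n. X n \<in> L2_sphere W"
    "\<And>n. Lp_norm lebesgue 2 (\<lambda>t. C t - X n t) < inverse (real (Suc n))"
    "\<And>n. \<not> Lp_norm (lebesgue_on Omega) p (\<lambda>x. error_shape \<gamma> C x - error_shape \<gamma> (X n) x) < \<epsilon>"
    by metis
  have "(\<lambda>n. Lp_norm lebesgue 2 (\<lambda>t. C t - X n t)) \<longlonglongrightarrow> 0"
    by (rule Lim_null_comparison[OF _ LIMSEQ_inverse_real_of_nat])
      (use X(2) in \<open>auto simp: Lp_norm_2 intro!: always_eventually less_imp_le simp del: of_nat_Suc\<close>)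
  then have "(\<lambda>n. Lp_norm (lebesgue_on Omega) p (\<lambda>x. error_shape \<gamma> C x - error_shape \<gamma> (X n) x)) \<longlonglongrightarrow> 0"
    by (rule error_shape_tendsto_Lp[OF C X(1) \<gamma> p])
  then have "\<forall>\<^sub>F n in sequentially. Lp_norm (lebesgue_on Omega) p (\<lambda>x. error_shape \<gamma> C x - error_shape \<gamma> (X n) x) < \<epsilon>"
    using \<epsilon> by (rule order_tendstoD)
  with X(3) show False by simp
qed

theorem theorem3p3p3:
  fixes W \<gamma> p :: real
  assumes "W \<ge> 1" and "\<gamma> \<ge> 1" and "p \<ge> 1"
  shows "(\<forall>C\<in>L2_sphere W. AE x in lebesgue_on Omega. error_shape_defined_at \<gamma> C x) \<and>
    continuous_map (subtopology (Lp_topology lebesgue 2) (L2_sphere W))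
      (Lp_topology (lebesgue_on Omega) p) (error_shape \<gamma>)"
proof
  have nz: "\<gamma> \<noteq> 0" "p > 0" "p \<ge> 0" using assms by auto
  show "\<forall>C\<in>L2_sphere W. AE x in lebesgue_on Omega. error_shape_defined_at \<gamma> C x"
    using error_shape_defined_AE nz(1) by blast
  show "continuous_map (subtopology (Lp_topology lebesgue 2) (L2_sphere W))
      (Lp_topology (lebesgue_on Omega) p) (error_shape \<gamma>)"
  proof (rule continuous_map_L2_subspace)
    show "L2_sphere W \<subseteq> Lp_space lebesgue 2"
      by (auto simp: L2_sphere_def L2_interval_def)
    show "error_shape \<gamma> C \<in> Lp_space (lebesgue_on Omega) p" if "C \<in> L2_sphere W" for C
      by (rule error_shape_in_Lp_space[OF L2_sphereD(1)[OF that] nz(3)])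
  qed (rule error_shape_continuous_at[OF _ nz(1,2)])
qed

end
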